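(* Let $m\ge2$ and consider a realization in $V$ of the dihedral Coxeter group $I(m)$ of order $2m$ with two simple roots $\alpha,\beta$ such that $-\alpha^\vee(\beta)=-\beta^\vee(\alpha)=2\cos\frac{\pi}{m}$. Let $a_n=\sin(n\pi/m)/\sin(\pi/m)$. Let $\mathbf i=(s_1,\dots,s_m)$ be a reduced decomposition of the longest element $w_0$. Then the string cone $C_{\mathbf i}$ is $$C_{\mathbf i}=\Big\{(x_1,\dots,x_m)\in\mathbb R_+^m:\ \frac{x_{m-1}}{a_{m-1}}\ge\frac{x_{m-2}}{a_{m-2}}\ge\cdots\ge\frac{x_1}{a_1}\Big\}.$$
   Context: $\mathbb R_+=[0,\infty)$. **Realization.** $V$ is a finite-dimensional real vector space with dual $V^\vee$, $\alpha,\beta\in V$, $\alpha^\vee,\beta^\vee\in V^\vee$, $\alpha^\vee(\alpha)=\beta^\vee(\beta)=2$, and $W=I(m)$ is generated by $s_\alpha(x)=x-\alpha^\vee(x)\alpha$ and $s_\beta(x)=x-\beta^\vee(x)\beta$. The two reduced decompositions of $w_0$ are the alternating words of length $m$, $(s_\alpha,s_\beta,s_\alpha,\dots)$ and $(s_\beta,s_\alpha,s_\beta,\dots)$; write $\alpha_k$ for the simple root of $s_k$. $\overline C=\{v:\alpha^\vee(v)\ge0,\beta^\vee(v)\ge0\}$. **Paths.** Fix $T>0$. $C_T^0(V)$ is the set of continuous paths $\eta:[0,T]\to V$ with $\eta(0)=0$; a path is dominant if it takes values in $\overline C$. For a simple root $\gamma$, $\mathcal P_\gamma\eta(t)=\eta(t)-\inf_{0\le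 u\le t}\gamma^\vee(\eta(u))\gamma$, and $\mathcal P_{w_0}=\mathcal P_{\alpha_1}\cdots\mathcal P_{\alpha_m}$ (independent of the reduced decomposition). **String cone.** For $\eta\in C_T^0(V)$ put $\eta_m=\eta$, $\eta_{k-1}=\mathcal P_{\alpha_k}\eta_k$, $x_k=-\min_{0\le t\le T}\alpha_k^\vee(\eta_k(t))$ for $k=m,\dots,1$, and $\varrho_{\mathbf i}(\eta)=(x_1,\dots,x_m)$. For $\pi$ dominant, $C_{\mathbf i}^\pi=\{\varrho_{\mathbf i}(\eta):\mathcal P_{w_0}\eta=\pi\}$ and $K_\pi=\{x\in\mathbb R^m:0\le x_r\le\alpha_r^\vee(\pi(T)-\sum_{n<r}x_n\alpha_n),\ r=1,\dots,m\}$. The string cone $C_{\mathbf i}$ is the unique polyhedral cone contained in $\mathbb R_+^m$ such that $C_{\mathbf i}^\pi=C_{\mathbf i}\cap K_\pi$ for every dominant path $\pi$; equivalently $C_{\mathbf i}=\bigcup_{\pi\text{ dominant}}C_{\mathbf i}^\pi$. *)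

theory Defs
  imports "HOL-Analysis.Analysis" "HOL-Library.FuncSet"
begin

text \<open>
  The space V is a type of class \<^class>\<open>euclidean_space\<close>; only its vector space structure and
  its topology are used. The simple roots and coroots are families \<open>rt\<close> and \<open>crt\<close> indexed by the
  two simple reflections. A word \<open>(s\<^sub>1, \<dots>, s\<^sub>m)\<close> is a list, so \<open>s\<^sub>k\<close> is \<open>ws ! (k - 1)\<close>. Elements
  of \<open>\<real>\<^sup>m\<close> are extensional functions on \<open>{1..m}\<close>.
\<close>

datatype simple = S_alpha | S_beta


section \<open>Realizations of the dihedral group\<close>

definition reflection :: "'a::real_vector \<Rightarrow> ('a \<Rightarrow> real) \<Rightarrow> 'a \<Rightarrow> 'a" where
  "reflection \<gamma> \<gamma>v x = x - \<gamma>v x *\<^sub>R \<gamma>"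

definition word_prod ::
  "(simple \<Rightarrow> 'a::real_vector) \<Rightarrow> (simple \<Rightarrow> 'a \<Rightarrow> real) \<Rightarrow> simple list \<Rightarrow> 'a \<Rightarrow> 'a" where
  "word_prod rt crt ws = foldr (\<lambda>i f. reflection (rt i) (crt i) \<circ> f) ws id"

text \<open>The reflections are involutions, so the monoid they generate is the group they generate.\<close>

definition coxeter_group ::
  "(simple \<Rightarrow> 'a::real_vector) \<Rightarrow> (simple \<Rightarrow> 'a \<Rightarrow> real) \<Rightarrow> ('a \<Rightarrow> 'a) set" where
  "coxeter_group rt crt = range (word_prod rt crt)"

definition coxeter_length ::
  "(simple \<Rightarrow> 'a::real_vector) \<Rightarrow> (simple \<Rightarrow> 'a \<Rightarrow> real) \<Rightarrow> ('a \<Rightarrow> 'a) \<Rightarrow> nat" where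
  "coxeter_length rt crt w = (LEAST n. \<exists>ws. length ws = n \<and> word_prod rt crt ws = w)"

definition reduced_decomposition ::
  "(simple \<Rightarrow> 'a::real_vector) \<Rightarrow> (simple \<Rightarrow> 'a \<Rightarrow> real) \<Rightarrow> simple list \<Rightarrow> ('a \<Rightarrow> 'a) \<Rightarrow> bool" where
  "reduced_decomposition rt crt ws w \<longleftrightarrow>
     word_prod rt crt ws = w \<and> length ws = coxeter_length rt crt w"

definition longest_element ::
  "(simple \<Rightarrow> 'a::real_vector) \<Rightarrow> (simple \<Rightarrow> 'a \<Rightarrow> real) \<Rightarrow> ('a \<Rightarrow> 'a) \<Rightarrow> bool" where
  "longest_element rt crt w \<longleftrightarrow>
     w \<in> coxeter_group rt crt \<and>
     (\<forall>v \<in> coxeter_group rt crt. coxeter_length rt crt v \<le> coxeter_length rt crt w)"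

text \<open>
  A group of order \<open>2 * m\<close>, \<open>m \<ge> 2\<close>, generated by two involutions is the dihedral group \<open>I(m)\<close>
  with these involutions as its Coxeter generators.
\<close>

definition dihedral_realization ::
  "nat \<Rightarrow> (simple \<Rightarrow> 'a::real_vector) \<Rightarrow> (simple \<Rightarrow> 'a \<Rightarrow> real) \<Rightarrow> bool" where
  "dihedral_realization m rt crt \<longleftrightarrow>
     (\<forall>i. linear (crt i) \<and> crt i (rt i) = 2) \<and> card (coxeter_group rt crt) = 2 * m"


section \<open>Paths and Pitman transforms\<close>

text \<open>Paths are functions on all of \<open>\<real>\<close> whose values outside \<open>[0, T]\<close> are ignored.\<close>

definition paths :: "real \<Rightarrow> (real \<Rightarrow> 'a::euclidean_space) set" where
  "paths T = {\<eta>. continuous_on {0..T} \<eta> \<and> \<eta> 0 = 0}"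

definition dominant_path ::
  "(simple \<Rightarrow> 'a::euclidean_space \<Rightarrow> real) \<Rightarrow> real \<Rightarrow> (real \<Rightarrow> 'a) \<Rightarrow> bool" where
  "dominant_path crt T \<pi> \<longleftrightarrow> \<pi> \<in> paths T \<and> (\<forall>t\<in>{0..T}. \<forall>i. 0 \<le> crt i (\<pi> t))"

definition pitman ::
  "'a::euclidean_space \<Rightarrow> ('a \<Rightarrow> real) \<Rightarrow> (real \<Rightarrow> 'a) \<Rightarrow> real \<Rightarrow> 'a" where
  "pitman \<gamma> \<gamma>v \<eta> t = \<eta> t - (INF u\<in>{0..t}. \<gamma>v (\<eta> u)) *\<^sub>R \<gamma>"

text \<open>\<open>\<P>\<^bsub>s\<^sub>1\<^esub> \<dots> \<P>\<^bsub>s\<^sub>k\<^esub>\<close> for the word \<open>[s\<^sub>1, \<dots>, s\<^sub>k]\<close>; the last letter acts first.\<close>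

definition pitman_word ::
  "(simple \<Rightarrow> 'a::euclidean_space) \<Rightarrow> (simple \<Rightarrow> 'a \<Rightarrow> real) \<Rightarrow> simple list \<Rightarrow>
     (real \<Rightarrow> 'a) \<Rightarrow> real \<Rightarrow> 'a" where
  "pitman_word rt crt ws = foldr (\<lambda>i. pitman (rt i) (crt i)) ws"


section \<open>String parameters and the string cone\<close>

text \<open>
  \<open>pitman_word rt crt (drop k ws) \<eta>\<close> is the path \<open>\<eta>\<^sub>k\<close>: it is \<open>\<eta>\<close> for \<open>k = m\<close>, and
  \<open>\<eta>\<^bsub>k-1\<^esub>\<close> is obtained from \<open>\<eta>\<^sub>k\<close> by the transform of the letter \<open>s\<^sub>k\<close>. The infimum below is
  attained, since \<open>\<eta>\<^sub>k\<close> is continuous on \<open>[0, T]\<close>.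
\<close>

definition string_params ::
  "(simple \<Rightarrow> 'a::euclidean_space) \<Rightarrow> (simple \<Rightarrow> 'a \<Rightarrow> real) \<Rightarrow> real \<Rightarrow> simple list \<Rightarrow>
     (real \<Rightarrow> 'a) \<Rightarrow> nat \<Rightarrow> real" where
  "string_params rt crt T ws \<eta> =
     (\<lambda>k\<in>{1..length ws}. - (INF t\<in>{0..T}. crt (ws ! (k - 1)) (pitman_word rt crt (drop k ws) \<eta> t)))"

definition string_set ::
  "(simple \<Rightarrow> 'a::euclidean_space) \<Rightarrow> (simple \<Rightarrow> 'a \<Rightarrow> real) \<Rightarrow> real \<Rightarrow> simple list \<Rightarrow>
     (real \<Rightarrow> 'a) \<Rightarrow> (nat \<Rightarrow> real) set" where
  "string_set rt crt T ws \<pi> =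
     {string_params rt crt T ws \<eta> |\<eta>.
        \<eta> \<in> paths T \<and> (\<forall>t\<in>{0..T}. pitman_word rt crt ws \<eta> t = \<pi> t)}"

definition string_polytope ::
  "(simple \<Rightarrow> 'a::euclidean_space) \<Rightarrow> (simple \<Rightarrow> 'a \<Rightarrow> real) \<Rightarrow> real \<Rightarrow> simple list \<Rightarrow>
     (real \<Rightarrow> 'a) \<Rightarrow> (nat \<Rightarrow> real) set" where
  "string_polytope rt crt T ws \<pi> =
     {x \<in> {1..length ws} \<rightarrow>\<^sub>E UNIV. \<forall>r\<in>{1..length ws}.
        0 \<le> x r \<and> x r \<le> crt (ws ! (r - 1)) (\<pi> T - (\<Sum>n\<in>{1..<r}. x n *\<^sub>R rt (ws ! (n - 1))))}"

text \<open>Finite intersections of closed linear half-spaces of \<open>\<real>\<^sup>m\<close>.\<close>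

definition polyhedral_cone :: "nat \<Rightarrow> (nat \<Rightarrow> real) set \<Rightarrow> bool" where
  "polyhedral_cone m C \<longleftrightarrow>
     (\<exists>F :: (nat \<Rightarrow> real) set. finite F \<and>
        C = {x \<in> {1..m} \<rightarrow>\<^sub>E UNIV. \<forall>f\<in>F. 0 \<le> (\<Sum>i\<in>{1..m}. f i * x i)})"

definition is_string_cone ::
  "(simple \<Rightarrow> 'a::euclidean_space) \<Rightarrow> (simple \<Rightarrow> 'a \<Rightarrow> real) \<Rightarrow> real \<Rightarrow> simple list \<Rightarrow>
     (nat \<Rightarrow> real) set \<Rightarrow> bool" where
  "is_string_cone rt crt T ws C \<longleftrightarrow>
     polyhedral_cone (length ws) C \<and>
     C \<subseteq> {1..length ws} \<rightarrow>\<^sub>E {0..} \<and>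
     (\<forall>\<pi>. dominant_path crt T \<pi> \<longrightarrow> string_set rt crt T ws \<pi> = C \<inter> string_polytope rt crt T ws \<pi>)"

definition string_cone ::
  "(simple \<Rightarrow> 'a::euclidean_space) \<Rightarrow> (simple \<Rightarrow> 'a \<Rightarrow> real) \<Rightarrow> real \<Rightarrow> simple list \<Rightarrow>
     (nat \<Rightarrow> real) set" where
  "string_cone rt crt T ws = (THE C. is_string_cone rt crt T ws C)"

end

theory Submission
  imports Defs
begin

text \<open>
  Write \<open>c = 2 cos (\<pi>/m)\<close>, \<open>y\<^sub>k(t) = - inf\<^bsub>[0,t]\<^esub> \<alpha>\<^sub>k\<^sup>\<or>(\<eta>\<^sub>k)\<close> and \<open>z\<^sub>k = \<alpha>\<^sub>k\<^sup>\<or>(\<eta>\<^bsub>k-1\<^esub>)\<close>. Then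
  \<open>y\<^sub>k \<le> z\<^sub>k\<close> and \<open>z\<^bsub>k+2\<^esub> = z\<^sub>k - 2 y\<^sub>k + c y\<^bsub>k+1\<^esub>\<close>, while \<open>a\<^bsub>k+2\<^esub> = c a\<^bsub>k+1\<^esub> - a\<^sub>k\<close> and \<open>a\<^sub>m = 0\<close>.
  At a time where the infimum defining \<open>y\<^sub>k\<close> is attained \<open>z\<^sub>k = y\<^sub>k\<close>, so that
  \<open>y\<^sub>k \<le> c y\<^bsub>k+1\<^esub> - y\<^bsub>k+2\<^esub>\<close> there; descending induction on \<open>k\<close>, starting from \<open>a\<^sub>m = 0\<close>, gives the
  inequalities of the cone, at every time. Conversely, a Pitman transform is inverted by
  subtracting \<open>min x\<^sub>k (inf\<^bsub>[t,T]\<^esub> z\<^sub>k) \<alpha>\<^sub>k\<close>, provided \<open>z\<^sub>k \<ge> 0\<close> on \<open>[0,T]\<close>; starting from a dominant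
  path, the inequalities of the cone yield \<open>a\<^sub>k z\<^bsub>k+1\<^esub> \<ge> a\<^bsub>k+1\<^esub> y\<^sub>k \<ge> 0\<close> by induction on \<open>k\<close>.
\<close>

section \<open>Running infima of continuous functions\<close>

lemma bdd_below_continuous_image:
  fixes f :: "real \<Rightarrow> real"
  assumes "continuous_on {a..b} f" "S \<subseteq> {a..b}"
  shows "bdd_below (f ` S)"
proof -
  have "compact (f ` {a..b})"
    using assms(1) by (intro compact_continuous_image) auto
  then have "bdd_below (f ` {a..b})"
    by (intro bounded_imp_bdd_below compact_imp_bounded)
  then show ?thesis
    using assms(2) by (meson bdd_below_mono image_mono)
qed

lemma continuous_INF_lower:
  fixes f :: "real \<Rightarrow> real"
  assumes "continuous_on {a..b} f" "S \<subseteq> {a..b}" "s \<in> S"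
  shows "(INF u\<in>S. f u) \<le> f s"
  using bdd_below_continuous_image[OF assms(1,2)] assms(3) by (rule cINF_lower)

lemma continuous_INF_antimono:
  fixes f :: "real \<Rightarrow> real"
  assumes "continuous_on {a..b} f" "S \<subseteq> {a..b}" "S' \<subseteq> S" "S' \<noteq> {}"
  shows "(INF u\<in>S. f u) \<le> (INF u\<in>S'. f u)"
  using assms bdd_below_continuous_image[OF assms(1,2)] by (intro cINF_superset_mono) auto

lemma continuous_INF_attained:
  fixes f :: "real \<Rightarrow> real"
  assumes "continuous_on {a..b} f" "a \<le> b"
  obtains u where "u \<in> {a..b}" "f u = (INF v\<in>{a..b}. f v)"
proof -
  obtain u where u: "u \<in> {a..b}" "\<And>v. v \<in> {a..b} \<Longrightarrow> f u \<le> f v"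
    using continuous_attains_inf[of "{a..b}" f] assms by auto
  have "(INF v\<in>{a..b}. f v) = f u"
    using u by (intro cInf_eq_minimum) auto
  with u(1) that show thesis by simp
qed

lemma continuous_on_running_INF:
  fixes f :: "real \<Rightarrow> real"
  assumes f: "continuous_on {a..b} f"
  shows "continuous_on {a..b} (\<lambda>t. INF u\<in>{a..t}. f u)"
  unfolding continuous_on_iff
proof (intro ballI allI impI)
  fix t e :: real
  assume t: "t \<in> {a..b}" and e: "e > 0"
  have "uniformly_continuous_on {a..b} f"
    using f by (intro compact_uniformly_continuous) auto
  then obtain d where d: "d > 0"
    "\<And>u v. u \<in> {a..b} \<Longrightarrow> v \<in> {a..b} \<Longrightarrow> dist u v < d \<Longrightarrow> dist (f u) (f v) < e / 2"
    using e unfolding uniformly_continuous_on_def by (metis half_gt_zero)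
  have close: "(INF u\<in>{a..r}. f u) \<le> (INF u\<in>{a..s}. f u) + e / 2"
    if r: "r \<in> {a..b}" and s: "s \<in> {a..b}" and rs: "dist r s < d" for r s
  proof -
    obtain u where u: "u \<in> {a..s}" "f u = (INF v\<in>{a..s}. f v)"
      using continuous_INF_attained[of a s f] s continuous_on_subset[OF f, of "{a..s}"] by auto
    \<comment> \<open>Cutting a minimiser on \<open>{a..s}\<close> off at \<open>r\<close> moves it
      by at most \<open>dist r s\<close> and lands in \<open>{a..r}\<close>.\<close>
    have "dist (f (min u r)) (f u) < e / 2"
      using u(1) r s rs d(1) by (intro d(2)) (auto simp: dist_real_def min_def)
    moreover have "(INF v\<in>{a..r}. f v) \<le> f (min u r)"
      using u(1) r by (intro continuous_INF_lower[OF f]) auto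
    ultimately show ?thesis
      using u(2) unfolding dist_real_def by linarith
  qed
  show "\<exists>d>0. \<forall>s\<in>{a..b}. dist s t < d \<longrightarrow>
      dist (INF u\<in>{a..s}. f u) (INF u\<in>{a..t}. f u) < e"
  proof (intro exI conjI ballI impI)
    fix s assume s: "s \<in> {a..b}" "dist s t < d"
    then show "dist (INF u\<in>{a..s}. f u) (INF u\<in>{a..t}. f u) < e"
      using close[OF s(1) t] close[OF t s(1)] e
      by (simp add: dist_real_def abs_less_iff)
  qed (rule d(1))
qed

lemma continuous_on_future_INF:
  fixes f :: "real \<Rightarrow> real"
  assumes f: "continuous_on {a..b} f"
  shows "continuous_on {a..b} (\<lambda>t. INF u\<in>{t..b}. f u)"
proof -
  \<comment> \<open>Reversing time turns future infima into running infima.\<close>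
  have "continuous_on {-b..-a} (\<lambda>s. f (- s))"
    by (intro continuous_on_compose2[OF f] continuous_intros) auto
  then have "continuous_on {-b..-a} (\<lambda>s. INF u\<in>{-b..s}. f (- u))"
    by (rule continuous_on_running_INF)
  then have "continuous_on {a..b} (\<lambda>t. INF u\<in>{-b..-t}. f (- u))"
    by (rule continuous_on_compose2) (auto intro!: continuous_intros)
  moreover have "(INF u\<in>{-b..-t}. f (- u)) = (INF u\<in>{t..b}. f u)" for t
  proof -
    have "f ` {t..b} = f ` uminus ` {-b..-t}"
      by simp
    then show ?thesis by (simp only: image_image)
  qed
  ultimately show ?thesis by simp
qed


section \<open>Inverting a Pitman transform\<close>

text \<open>The cap \<open>x\<close> is the prescribed string parameter: when
  \<open>x \<le> g T\<close>, the value at \<open>T\<close> is exactly \<open>x\<close>.\<close>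

definition future_min :: "real \<Rightarrow> (real \<Rightarrow> real) \<Rightarrow> real \<Rightarrow> real \<Rightarrow> real" where
  "future_min x g T t = min x (INF u\<in>{t..T}. g u)"

lemma continuous_on_future_min:
  assumes "continuous_on {0..T} g"
  shows "continuous_on {0..T} (future_min x g T)"
  unfolding future_min_def using continuous_on_future_INF[OF assms] by (intro continuous_intros)

lemma future_min_le:
  assumes "continuous_on {0..T} g" "t \<in> {0..T}"
  shows "future_min x g T t \<le> g t"
proof -
  have "(INF u\<in>{t..T}. g u) \<le> g t"
    using assms by (intro continuous_INF_lower[OF assms(1)]) auto
  then show ?thesis by (simp add: future_min_def)
qed

lemma future_min_mono:
  assumes "continuous_on {0..T} g" "0 \<le> s" "s \<le> t" "t \<le> T"
  shows "future_min x g T s \<le> future_min x g T t"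
proof -
  have "(INF u\<in>{s..T}. g u) \<le> (INF u\<in>{t..T}. g u)"
    using assms by (intro continuous_INF_antimono[OF assms(1)]) auto
  then show ?thesis by (simp add: future_min_def)
qed

lemma future_min_greatest:
  assumes "t \<le> T" "z \<le> x" "\<And>u. t \<le> u \<Longrightarrow> u \<le> T \<Longrightarrow> z \<le> g u"
  shows "z \<le> future_min x g T t"
proof -
  have "z \<le> (INF u\<in>{t..T}. g u)"
    using assms by (intro cINF_greatest) auto
  then show ?thesis using assms(2) by (simp add: future_min_def)
qed

text \<open>One-dimensional core of the inversion. Writing \<open>y\<close> for
  \<open>future_min x g T\<close>, the lower bound is
  \<open>g u - 2 * y u \<ge> - y u \<ge> - y t\<close>, from \<open>y \<le> g\<close> and
  monotonicity of \<open>y\<close>. Equality needs a time \<open>u \<le> t\<close> with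
  \<open>g u = y u = y t\<close>.\<close>

lemma INF_future_min:
  assumes g: "continuous_on {0..T} g" and g0: "g 0 = 0"
    and nonneg: "\<And>t. t \<in> {0..T} \<Longrightarrow> 0 \<le> g t" and x: "0 \<le> x"
    and t: "t \<in> {0..T}"
  shows "(INF u\<in>{0..t}. g u - 2 * future_min x g T u) = - future_min x g T t"
proof (rule cInf_eq_minimum)
  let ?y = "future_min x g T"
  fix r assume "r \<in> (\<lambda>u. g u - 2 * ?y u) ` {0..t}"
  then obtain u where u: "u \<in> {0..t}" "r = g u - 2 * ?y u" by blast
  have "?y u \<le> g u" "?y u \<le> ?y t"
    using u t by (auto intro!: future_min_le future_min_mono g)
  with u(2) show "- ?y t \<le> r" by simp
next
  let ?y = "future_min x g T"
  have y0: "0 \<le> ?y t"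
    using t x nonneg by (intro future_min_greatest) auto
  have cont: "continuous_on {0..t} g"
    using t by (intro continuous_on_subset[OF g]) auto
  \<comment> \<open>At the last time \<open>u \<le> t\<close> at which \<open>g\<close> takes the value \<open>?y t\<close>, also \<open>?y\<close> takes this value.\<close>
  let ?S = "{u \<in> {0..t}. g u = ?y t}"
  have "compact ?S"
    unfolding compact_eq_bounded_closed
    using continuous_closed_preimage_constant[OF cont, of "?y t"]
    by (auto intro: bounded_subset[of "{0..t}"])
  \<comment> \<open>Since \<open>g 0 = 0 \<le> ?y t \<le> g t\<close>, the intermediate value
    theorem applies.\<close>
  moreover have "?S \<noteq> {}"
    using IVT'[of g 0 "?y t" t] y0 g0 t cont future_min_le[OF g t, of x] by force
  ultimately obtain u where u: "u \<in> ?S" "\<And>v. v \<in> ?S \<Longrightarrow> v \<le> u"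
    using compact_attains_sup[of ?S] by (metis (no_types, lifting))
  \<comment> \<open>After \<open>u\<close> the function \<open>g\<close> stays above the level
    \<open>?y t\<close>: before \<open>t\<close>, a drop below it would force a later crossing;
    after \<open>t\<close>, monotonicity of \<open>?y\<close> suffices.\<close>
  have "?y t \<le> g v" if v: "u \<le> v" "v \<le> T" for v
  proof (cases "v \<le> t")
    case True
    show ?thesis
    proof (rule ccontr)
      assume "\<not> ?y t \<le> g v"
      then have gv: "g v < ?y t" by simp
      have "continuous_on {v..t} g"
        using v(1) u(1) by (intro continuous_on_subset[OF cont]) auto
      then obtain w where w: "v \<le> w" "w \<le> t" "g w = ?y t"
        using IVT'[of g v "?y t" t] True gv future_min_le[OF g t, of x] by auto
      with v(1) u(1) have "w \<in> ?S" by auto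
      then have "w \<le> u" by (rule u(2))
      with w v(1) gv show False by (metis order_antisym less_irrefl order_trans)
    qed
  next
    case False
    with v t have "?y t \<le> ?y v" "?y v \<le> g v"
      by (auto intro!: future_min_mono future_min_le g)
    then show ?thesis by simp
  qed
  moreover have "?y t \<le> x" by (simp add: future_min_def)
  ultimately have "?y t \<le> ?y u"
    using u(1) t by (intro future_min_greatest) auto
  moreover have "?y u \<le> ?y t"
    using u(1) t by (intro future_min_mono g) auto
  ultimately have "- ?y t = g u - 2 * ?y u"
    using u(1) by simp
  with u(1) show "- ?y t \<in> (\<lambda>u. g u - 2 * ?y u) ` {0..t}" by blast
qed

lemma continuous_on_linear_compose:
  fixes \<gamma>v :: "'a::euclidean_space \<Rightarrow> real"
  and S :: "real set"
  assumes "linear \<gamma>v" "continuous_on S \<eta>"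
  shows "continuous_on S (\<lambda>t. \<gamma>v (\<eta> t))"
  using linear_continuous_on_compose[OF assms(2,1)] .

lemma pitman_in_paths:
  assumes "linear \<gamma>v" "\<eta> \<in> paths T"
  shows "pitman \<gamma> \<gamma>v \<eta> \<in> paths T"
proof -
  have cont: "continuous_on {0..T} \<eta>" and "\<eta> 0 = 0"
    using assms(2) by (auto simp: paths_def)
  have "continuous_on {0..T} (\<lambda>t. INF u\<in>{0..t}. \<gamma>v (\<eta> u))"
    by (rule continuous_on_running_INF[OF continuous_on_linear_compose[OF assms(1) cont]])
  then have "continuous_on {0..T} (pitman \<gamma> \<gamma>v \<eta>)"
    unfolding pitman_def by (intro continuous_intros cont)
  moreover have "pitman \<gamma> \<gamma>v \<eta> 0 = 0"
    using \<open>\<eta> 0 = 0\<close> linear_0[OF assms(1)] by (simp add: pitman_def)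
  ultimately show ?thesis by (simp add: paths_def)
qed

lemma pitman_cong:
  assumes "\<And>t. t \<in> {0..T} \<Longrightarrow> \<eta> t = \<eta>' t" "t \<in> {0..T}"
  shows "pitman \<gamma> \<gamma>v \<eta> t = pitman \<gamma> \<gamma>v \<eta>' t"
proof -
  have "(INF u\<in>{0..t}. \<gamma>v (\<eta> u)) = (INF u\<in>{0..t}. \<gamma>v (\<eta>' u))"
    using assms by (intro INF_cong) auto
  with assms show ?thesis by (simp add: pitman_def)
qed

definition inverse_pitman ::
  "'a::euclidean_space \<Rightarrow> ('a \<Rightarrow> real) \<Rightarrow> real \<Rightarrow> real \<Rightarrow> (real \<Rightarrow> 'a) \<Rightarrow> real \<Rightarrow> 'a" where
  "inverse_pitman \<gamma> \<gamma>v T x \<zeta> t = \<zeta> t - future_min x (\<lambda>u. \<gamma>v (\<zeta> u)) T t *\<^sub>R \<gamma>"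

lemma inverse_pitman_coroot:
  assumes "linear \<delta>v"
  shows "\<delta>v (inverse_pitman \<gamma> \<gamma>v T x \<zeta> t) =
    \<delta>v (\<zeta> t) - \<delta>v \<gamma> * future_min x (\<lambda>u. \<gamma>v (\<zeta> u)) T t"
  using assms by (simp add: inverse_pitman_def linear_diff linear_scale)

context
  fixes \<gamma> :: "'a::euclidean_space" and \<gamma>v :: "'a \<Rightarrow> real" and T x :: real and \<zeta> :: "real \<Rightarrow> 'a"
  assumes lin: "linear \<gamma>v" and two: "\<gamma>v \<gamma> = 2"
    and path: "\<zeta> \<in> paths T" and nonneg: "\<And>t. t \<in> {0..T} \<Longrightarrow> 0 \<le> \<gamma>v (\<zeta> t)"
    and x: "0 \<le> x"
begin

lemma continuous_on_coroot_path: "continuous_on {0..T} (\<lambda>u. \<gamma>v (\<zeta> u))"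
  using path by (intro continuous_on_linear_compose[OF lin]) (simp add: paths_def)

lemma future_min_coroot_nonneg:
  "t \<in> {0..T} \<Longrightarrow> 0 \<le> future_min x (\<lambda>u. \<gamma>v (\<zeta> u)) T t"
  using x nonneg by (intro future_min_greatest) auto

lemma INF_inverse_pitman:
  assumes "t \<in> {0..T}"
  shows "(INF u\<in>{0..t}. \<gamma>v (inverse_pitman \<gamma> \<gamma>v T x \<zeta> u)) = - future_min x (\<lambda>u. \<gamma>v (\<zeta> u)) T t"
  unfolding inverse_pitman_coroot[OF lin] two
  using path x nonneg assms linear_0[OF lin]
  by (intro INF_future_min continuous_on_coroot_path) (auto simp: paths_def)

lemma inverse_pitman_in_paths:
  assumes "0 \<le> T"
  shows "inverse_pitman \<gamma> \<gamma>v T x \<zeta> \<in> paths T"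
proof -
  \<comment> \<open>The subtracted term is squeezed to 0 at time 0, so the new path still starts at
    the origin.\<close>
  have "future_min x (\<lambda>u. \<gamma>v (\<zeta> u)) T 0 \<le> \<gamma>v (\<zeta> 0)"
    using assms by (intro future_min_le continuous_on_coroot_path) auto
  then have "future_min x (\<lambda>u. \<gamma>v (\<zeta> u)) T 0 = 0"
    using future_min_coroot_nonneg[of 0] path assms linear_0[OF lin] by (simp add: paths_def)
  moreover have "continuous_on {0..T} (inverse_pitman \<gamma> \<gamma>v T x \<zeta>)"
    unfolding inverse_pitman_def using path continuous_on_future_min[OF continuous_on_coroot_path]
    by (intro continuous_on_diff continuous_on_scaleR continuous_on_const) (auto simp: paths_def)
  ultimately show ?thesis
    using path by (simp add: paths_def inverse_pitman_def)
qed

lemma pitman_inverse_pitman: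
  assumes "t \<in> {0..T}"
  shows "pitman \<gamma> \<gamma>v (inverse_pitman \<gamma> \<gamma>v T x \<zeta>) t = \<zeta> t"
  unfolding pitman_def INF_inverse_pitman[OF assms] by (simp add: inverse_pitman_def)

end


section \<open>Reduced words\<close>

lemma word_prod_append: "word_prod rt crt (us @ vs) = word_prod rt crt us \<circ> word_prod rt crt vs"
  by (induction us) (auto simp: word_prod_def)

text \<open>Two equal adjacent letters cancel because a reflection is an involution, leaving a
  shorter word for the same element.\<close>

lemma reduced_decomposition_alternating:
  assumes "\<And>i. linear (crt i)" "\<And>i. crt i (rt i) = 2"
    and red: "reduced_decomposition rt crt ws w" and k: "Suc k < length ws"
  shows "ws ! k \<noteq> ws ! Suc k"
proof
  assume eq: "ws ! k = ws ! Suc k"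
  let ?us = "take k ws" and ?vs = "drop (Suc (Suc k)) ws"
  have "ws = ?us @ [ws ! k, ws ! k] @ ?vs"
    using k eq by (metis Cons_nth_drop_Suc Suc_lessD append_Cons append_Nil append_take_drop_id)
  moreover have "word_prod rt crt [i, i] = id" for i
    using assms(1,2)[of i]
    by (auto simp: word_prod_def reflection_def fun_eq_iff linear_diff linear_scale)
  ultimately have "word_prod rt crt (?us @ ?vs) = w"
    using red unfolding reduced_decomposition_def by (metis word_prod_append id_comp)
  then have "coxeter_length rt crt w \<le> length (?us @ ?vs)"
    unfolding coxeter_length_def by (intro Least_le) blast
  moreover have "length (?us @ ?vs) < length ws"
    using k by simp
  ultimately show False
    using red by (simp add: reduced_decomposition_def)
qed


section \<open>The cone inequalities\<close>

text \<open>Trigonometry enters only through the recursion for \<open>a\<close>, its positivity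
  below \<open>length ws\<close> and its vanishing there. Letters are counted from 0 and parameters
  from 1, so \<open>ws ! k\<close> belongs to the parameter of index \<open>Suc k\<close>.\<close>

locale dihedral_word =
  fixes rt :: "simple \<Rightarrow> 'a::euclidean_space" and crt :: "simple \<Rightarrow> 'a \<Rightarrow> real"
    and c :: real and ws :: "simple list" and a :: "nat \<Rightarrow> real" and T :: real
  assumes crt_linear: "linear (crt i)"
    and crt_rt: "crt i (rt i) = 2"
    and crt_rt_distinct: "i \<noteq> j \<Longrightarrow> crt i (rt j) = - c"
    and alternating: "Suc k < length ws \<Longrightarrow> ws ! k \<noteq> ws ! Suc k"
    and a_0: "a 0 = 0" and a_1: "a (Suc 0) = 1"
    and a_rec: "a (Suc (Suc k)) = c * a (Suc k) - a k"
    and a_pos: "0 < k \<Longrightarrow> k < length ws \<Longrightarrow> 0 < a k"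
    and a_length: "a (length ws) = 0"
    and T_pos: "0 < T"
begin

lemma letter_Suc_Suc:
  assumes "Suc (Suc k) < length ws"
  shows "ws ! Suc (Suc k) = ws ! k"
  using alternating[of k] alternating[of "Suc k"] assms
  by (cases "ws ! k"; cases "ws ! Suc k"; cases "ws ! Suc (Suc k)") auto

lemma pitman_word_drop:
  assumes "k < length ws"
  shows "pitman_word rt crt (drop k ws) \<eta> =
    pitman (rt (ws ! k)) (crt (ws ! k)) (pitman_word rt crt (drop (Suc k) ws) \<eta>)"
  using assms by (subst Cons_nth_drop_Suc[symmetric]) (simp_all add: pitman_word_def)

lemma pitman_word_in_paths:
  assumes "\<eta> \<in> paths T"
  shows "pitman_word rt crt us \<eta> \<in> paths T"
  using assms by (induction us) (auto simp: pitman_word_def intro!: pitman_in_paths crt_linear)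

text \<open>\<open>partial_param \<eta> k t\<close> is the string parameter of index \<open>k + 1\<close> of the path restricted to \<open>[0, t]\<close>.\<close>

definition partial_param :: "(real \<Rightarrow> 'a) \<Rightarrow> nat \<Rightarrow> real \<Rightarrow> real" where
  "partial_param \<eta> k t =
     - (INF u\<in>{0..t}. crt (ws ! k) (pitman_word rt crt (drop (Suc k) ws) \<eta> u))"

lemma string_params_eq:
  "k < length ws \<Longrightarrow> string_params rt crt T ws \<eta> (Suc k) = partial_param \<eta> k T"
  by (simp add: string_params_def partial_param_def)

section \<open>Necessity of the cone inequalities\<close>

context
  fixes \<eta> :: "real \<Rightarrow> 'a"
  assumes path: "\<eta> \<in> paths T"
begin

lemma continuous_on_coroot_pitman_word:
  "continuous_on {0..T} (\<lambda>t. crt i (pitman_word rt crt us \<eta> t))"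
  using pitman_word_in_paths[OF path, of us]
  by (intro continuous_on_linear_compose[OF crt_linear]) (simp add: paths_def)

lemma partial_param_ge:
  assumes "t \<in> {0..T}"
  shows "- crt (ws ! k) (pitman_word rt crt (drop (Suc k) ws) \<eta> t) \<le> partial_param \<eta> k t"
  unfolding partial_param_def
  using continuous_INF_lower[OF continuous_on_coroot_pitman_word, of "{0..t}" t] assms by simp

lemma partial_param_mono:
  assumes "0 \<le> s" "s \<le> t" "t \<le> T"
  shows "partial_param \<eta> k s \<le> partial_param \<eta> k t"
  unfolding partial_param_def
  using continuous_INF_antimono[OF continuous_on_coroot_pitman_word, of "{0..t}" "{0..s}"] assms
  by simp

lemma partial_param_nonneg:
  assumes "t \<in> {0..T}"
  shows "0 \<le> partial_param \<eta> k t"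
proof -
  have "0 \<le> partial_param \<eta> k 0"
    using partial_param_ge[of 0 k] pitman_word_in_paths[OF path] T_pos linear_0[OF crt_linear]
    by (simp add: paths_def)
  also have "\<dots> \<le> partial_param \<eta> k t"
    using assms by (intro partial_param_mono) auto
  finally show ?thesis .
qed

lemma partial_param_attained:
  assumes "s \<in> {0..T}"
  obtains t where "t \<in> {0..s}" "partial_param \<eta> k t = partial_param \<eta> k s"
    "crt (ws ! k) (pitman_word rt crt (drop (Suc k) ws) \<eta> t) = - partial_param \<eta> k s"
proof -
  let ?f = "\<lambda>u. crt (ws ! k) (pitman_word rt crt (drop (Suc k) ws) \<eta> u)"
  obtain t where t: "t \<in> {0..s}" "?f t = (INF u\<in>{0..s}. ?f u)"
    using continuous_INF_attained[of 0 s ?f] assms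
      continuous_on_subset[OF continuous_on_coroot_pitman_word, of "{0..s}"] by auto
  have "?f t = - partial_param \<eta> k s"
    using t(2) by (simp add: partial_param_def)
  moreover from this have "partial_param \<eta> k t = partial_param \<eta> k s"
    using partial_param_ge[of t k] partial_param_mono[of t s k] t(1) assms by auto
  ultimately show thesis using t(1) that by blast
qed

lemma pitman_word_step:
  assumes "k < length ws"
  shows "pitman_word rt crt (drop k ws) \<eta> t =
    pitman_word rt crt (drop (Suc k) ws) \<eta> t + partial_param \<eta> k t *\<^sub>R rt (ws ! k)"
  by (simp add: pitman_word_drop[OF assms] pitman_def partial_param_def)

text \<open>Adding \<open>partial_param \<eta> k t\<close> times the root raises the coroot by twice
  that amount, and the coroot was at least minus that amount before.\<close>

lemma partial_param_le:
  assumes "k < length ws" "t \<in> {0..T}"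
  shows "partial_param \<eta> k t \<le> crt (ws ! k) (pitman_word rt crt (drop k ws) \<eta> t)"
  using partial_param_ge[OF assms(2), of k]
  by (simp add: pitman_word_step[OF assms(1)] linear_add[OF crt_linear]
      linear_scale[OF crt_linear] crt_rt)

text \<open>The descending induction keeps the time arbitrary: its step passes from \<open>s\<close>
  to the time \<open>t \<le> s\<close> at which the infimum of index \<open>k\<close> is attained,
  and uses the next inequality at \<open>t\<close>.\<close>

lemma partial_param_ratio:
  assumes "Suc k < length ws" "s \<in> {0..T}"
  shows "partial_param \<eta> k s * a (Suc (Suc k)) \<le> partial_param \<eta> (Suc k) s * a (Suc k)"
  using assms
proof (induction "length ws - k" arbitrary: k s rule: less_induct)
  case less
  let ?y = "partial_param \<eta>"
  show ?case
  proof (cases "Suc (Suc k) < length ws")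
    case False
    \<comment> \<open>Here \<open>a (Suc (Suc k))\<close> is 0, so the left side vanishes.\<close>
    then have "Suc (Suc k) = length ws" using less.prems by simp
    then show ?thesis
      using partial_param_nonneg[OF less.prems(2)] a_pos[of "Suc k"] a_length less.prems by simp
  next
    case True
    obtain t where t: "t \<in> {0..s}" "?y k t = ?y k s"
      "crt (ws ! k) (pitman_word rt crt (drop (Suc k) ws) \<eta> t) = - ?y k s"
      using partial_param_attained[OF less.prems(2)] .
    have tT: "t \<in> {0..T}" using t(1) less.prems by auto
    have "crt (ws ! k) (rt (ws ! Suc k)) = - c"
      using alternating[OF less.prems(1)] by (rule crt_rt_distinct)
    then have "crt (ws ! k) (pitman_word rt crt (drop (Suc (Suc k)) ws) \<eta> t) =
        c * ?y (Suc k) t - ?y k s"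
      using t(3) by (simp add: pitman_word_step[OF less.prems(1)] linear_add[OF crt_linear]
          linear_scale[OF crt_linear] algebra_simps)
    then have "?y k s \<le> c * ?y (Suc k) t - ?y (Suc (Suc k)) t"
      using partial_param_le[OF True tT] letter_Suc_Suc[OF True] by simp
    then have "?y k s * a (Suc (Suc k)) \<le>
        (c * ?y (Suc k) t - ?y (Suc (Suc k)) t) * a (Suc (Suc k))"
      using a_pos[OF _ True] by (intro mult_right_mono) auto
    also have "\<dots> \<le> c * ?y (Suc k) t * a (Suc (Suc k)) - ?y (Suc k) t * a (Suc (Suc (Suc k)))"
      using less.hyps[of "Suc k" t] True tT by (simp add: algebra_simps)
    also have "\<dots> = ?y (Suc k) t * a (Suc k)"
      by (simp add: a_rec[of "Suc k"] algebra_simps)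
    \<comment> \<open>Between \<open>t\<close> and \<open>s\<close> the parameter of
      \<open>k\<close> is constant, while that of \<open>Suc k\<close> can only grow, which is the
      favourable direction.\<close>
    also have "\<dots> \<le> ?y (Suc k) s * a (Suc k)"
      using t(1) less.prems a_pos[of "Suc k"]
      by (intro mult_right_mono partial_param_mono) auto
    finally show ?thesis .
  qed
qed

text \<open>Telescoping \<open>pitman_word_step\<close> at time \<open>T\<close> turns the bounds of
  \<open>partial_param_le\<close> into the inequalities of \<open>string_polytope\<close>.\<close>

lemma pitman_word_end:
  assumes "k \<le> length ws"
  shows "pitman_word rt crt (drop k ws) \<eta> T =
    pitman_word rt crt ws \<eta> T - (\<Sum>n\<in>{1..<Suc k}. string_params rt crt T ws \<eta> n *\<^sub>R rt (ws ! (n - 1)))"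
  using assms
proof (induction k)
  case (Suc k)
  then show ?case
    using pitman_word_step[of k T] by (simp add: string_params_eq algebra_simps)
qed simp

end

text \<open>Cross-multiplied, the inequalities are linear in \<open>x\<close>. The last coordinate
  is constrained only by its sign.\<close>

definition cone :: "(nat \<Rightarrow> real) set" where
  "cone = {x \<in> {1..length ws} \<rightarrow>\<^sub>E {0..}.
     \<forall>k. Suc (Suc k) < length ws \<longrightarrow> x (Suc k) * a (Suc (Suc k)) \<le> x (Suc (Suc k)) * a (Suc k)}"

lemma string_set_subset: "string_set rt crt T ws \<pi> \<subseteq> cone \<inter> string_polytope rt crt T ws \<pi>"
proof
  fix x assume "x \<in> string_set rt crt T ws \<pi>"
  then obtain \<eta> where x: "x = string_params rt crt T ws \<eta>" and path: "\<eta> \<in> paths T"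
    and \<pi>: "\<And>t. t \<in> {0..T} \<Longrightarrow> pitman_word rt crt ws \<eta> t = \<pi> t"
    unfolding string_set_def by blast
  have T: "T \<in> {0..T}" using T_pos by simp
  have xk: "x (Suc k) = partial_param \<eta> k T" if "k < length ws" for k
    using that by (simp add: x string_params_eq)
  have nonneg: "0 \<le> x r" if "r \<in> {1..length ws}" for r
    using that partial_param_nonneg[OF path T] xk[of "r - 1"] by auto
  have ext: "x \<in> extensional {1..length ws}"
    unfolding x string_params_def by simp
  have "x \<in> cone"
    unfolding cone_def using ext nonneg partial_param_ratio[OF path _ T] xk
    by (auto simp: PiE_iff)
  moreover have "x r \<le> crt (ws ! (r - 1)) (\<pi> T - (\<Sum>n\<in>{1..<r}. x n *\<^sub>R rt (ws ! (n - 1))))"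
    if r: "r \<in> {1..length ws}" for r
    using partial_param_le[OF path _ T, of "r - 1"] xk[of "r - 1"] r
      pitman_word_end[OF path, of "r - 1"] \<pi>[OF T] by (auto simp flip: x)
  ultimately show "x \<in> cone \<inter> string_polytope rt crt T ws \<pi>"
    unfolding string_polytope_def using ext nonneg by (auto simp: PiE_iff)
qed

section \<open>Sufficiency: rebuilding a path from its end result and its parameters\<close>

fun lowered_path :: "(nat \<Rightarrow> real) \<Rightarrow> (real \<Rightarrow> 'a) \<Rightarrow> nat \<Rightarrow> real \<Rightarrow> 'a" where
  "lowered_path x \<pi> 0 = \<pi>"
| "lowered_path x \<pi> (Suc k) =
     inverse_pitman (rt (ws ! k)) (crt (ws ! k)) T (x (Suc k)) (lowered_path x \<pi> k)"

context
  fixes \<pi> :: "real \<Rightarrow> 'a" and x :: "nat \<Rightarrow> real"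
  assumes dominant: "dominant_path crt T \<pi>"
    and x_cone: "x \<in> cone" and x_polytope: "x \<in> string_polytope rt crt T ws \<pi>"
begin

abbreviation z :: "nat \<Rightarrow> real \<Rightarrow> real" where
  "z k t \<equiv> crt (ws ! k) (lowered_path x \<pi> k t)"

abbreviation y :: "nat \<Rightarrow> real \<Rightarrow> real" where
  "y k \<equiv> future_min (x (Suc k)) (z k) T"

lemma x_nonneg: "k < length ws \<Longrightarrow> 0 \<le> x (Suc k)"
  using x_cone by (auto simp: cone_def PiE_iff)

lemma crt_lowered_path_Suc:
  "crt i (lowered_path x \<pi> (Suc k) t) = crt i (lowered_path x \<pi> k t) - crt i (rt (ws ! k)) * y k t"
  by (simp add: inverse_pitman_coroot[OF crt_linear])

text \<open>The claims are proved together because inverting the transform at stage \<open>k\<close>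
  requires \<open>z k\<close> to be nonnegative, and this nonnegativity comes from the ratio
  inequality of the stage before.\<close>

lemma lowered_path_ratio:
  assumes "k < length ws"
  shows "lowered_path x \<pi> k \<in> paths T \<and> (\<forall>t\<in>{0..T}. 0 \<le> z k t \<and>
    (Suc k < length ws \<longrightarrow> a (Suc (Suc k)) * y k t \<le> a (Suc k) * z (Suc k) t))"
  using assms
proof (induction k)
  case 0
  \<comment> \<open>Since \<open>a 1 = 1\<close> and \<open>a 2 = c\<close>, the ratio inequality
    says that the coroot of the dominant path is nonnegative.\<close>
  have "z 1 t = crt (ws ! 1) (\<pi> t) + c * y 0 t" if "Suc 0 < length ws" for t
    using crt_lowered_path_Suc[of "ws ! 1" 0 t] crt_rt_distinct[OF alternating[OF that, symmetric]]
    by simp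
  then show ?case
    using dominant a_rec[of 0] a_0 a_1 by (auto simp: dominant_path_def)
next
  case (Suc k)
  then have path: "lowered_path x \<pi> k \<in> paths T" and z: "\<And>t. t \<in> {0..T} \<Longrightarrow> 0 \<le> z k t"
    and ratio: "\<And>t. t \<in> {0..T} \<Longrightarrow> a (Suc (Suc k)) * y k t \<le> a (Suc k) * z (Suc k) t"
    by auto
  have k: "k < length ws" using Suc.prems by simp
  note facts = crt_linear crt_rt path z x_nonneg[OF k]
  \<comment> \<open>The second value is 0 when \<open>Suc k\<close> is the last letter, hence only a
    weak inequality.\<close>
  have a: "0 < a (Suc k)" "0 \<le> a (Suc (Suc k))"
    using a_pos[of "Suc k"] a_pos[of "Suc (Suc k)"] a_length Suc.prems
    by (cases "Suc (Suc k) = length ws"; force)+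
  have cont: "continuous_on {0..T} (z k)"
    by (rule continuous_on_coroot_path[OF facts])
  have path': "lowered_path x \<pi> (Suc k) \<in> paths T"
    unfolding lowered_path.simps
    by (rule inverse_pitman_in_paths[OF facts]) (use T_pos in auto)
  have y: "0 \<le> y k t" if "t \<in> {0..T}" for t
    by (rule future_min_coroot_nonneg[OF facts that])
  have z': "0 \<le> z (Suc k) t" if t: "t \<in> {0..T}" for t
  proof -
    have "0 \<le> a (Suc k) * z (Suc k) t"
      using ratio[OF t] y[OF t] a(2) by (meson mult_nonneg_nonneg order_trans)
    then show ?thesis using a(1) by (simp add: zero_le_mult_iff)
  qed
  have cont': "continuous_on {0..T} (z (Suc k))"
    using path' by (intro continuous_on_linear_compose[OF crt_linear]) (simp add: paths_def)
  \<comment> \<open>Both terms of the minimum defining \<open>y (Suc k) t\<close> are bounded below: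
    the cap by the cone inequality for \<open>x\<close>, the future infimum by the ratio inequality
    at later times and monotonicity of \<open>y k\<close>.\<close>
  have yy: "a (Suc (Suc k)) * y k t \<le> a (Suc k) * y (Suc k) t" if "Suc (Suc k) < length ws" and t: "t \<in> {0..T}" for t
  proof -
    have "a (Suc (Suc k)) * y k t / a (Suc k) \<le> y (Suc k) t"
    proof (rule future_min_greatest)
      have "a (Suc (Suc k)) * y k t \<le> a (Suc (Suc k)) * x (Suc k)"
        using a by (intro mult_left_mono) (auto simp: future_min_def)
      also have "\<dots> \<le> a (Suc k) * x (Suc (Suc k))"
        using x_cone that by (simp add: cone_def mult.commute)
      finally show "a (Suc (Suc k)) * y k t / a (Suc k) \<le> x (Suc (Suc k))"
        using a by (simp add: field_simps)
    next
      fix u assume u: "t \<le> u" "u \<le> T"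
      have "a (Suc (Suc k)) * y k t \<le> a (Suc (Suc k)) * y k u"
        using a u t by (intro mult_left_mono future_min_mono[OF cont]) auto
      also have "\<dots> \<le> a (Suc k) * z (Suc k) u"
        using u t by (intro ratio) auto
      finally show "a (Suc (Suc k)) * y k t / a (Suc k) \<le> z (Suc k) u"
        using a by (simp add: field_simps)
    qed (use t in auto)
    then show ?thesis using a by (simp add: field_simps)
  qed
  have "a (Suc (Suc (Suc k))) * y (Suc k) t \<le> a (Suc (Suc k)) * z (Suc (Suc k)) t"
    if "Suc (Suc k) < length ws" and t: "t \<in> {0..T}" for t
  proof -
    have "crt (ws ! k) (rt (ws ! Suc k)) = - c"
      using alternating[of k] Suc.prems by (intro crt_rt_distinct) auto
    then have "z (Suc (Suc k)) t = z k t - 2 * y k t + c * y (Suc k) t"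
      using letter_Suc_Suc[OF that(1)]
      by (simp only: crt_lowered_path_Suc crt_rt)
    then have "c * y (Suc k) t - y k t \<le> z (Suc (Suc k)) t"
      using future_min_le[OF cont t, of "x (Suc k)"] by simp
    then have "a (Suc (Suc k)) * (c * y (Suc k) t - y k t) \<le> a (Suc (Suc k)) * z (Suc (Suc k)) t"
      using a by (intro mult_left_mono) auto
    \<comment> \<open>After expanding \<open>a (Suc (Suc (Suc k)))\<close> by the recursion and
      cancelling the term with \<open>c\<close>, this is exactly \<open>yy\<close>.\<close>
    moreover have "a (Suc (Suc (Suc k))) * y (Suc k) t \<le>
        a (Suc (Suc k)) * (c * y (Suc k) t - y k t)"
      using yy[OF that] by (simp add: a_rec[of "Suc k"] algebra_simps)
    ultimately show ?thesis by linarith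
  qed
  with path' z' show ?case by simp
qed

text \<open>The fully lowered path is the preimage: each Pitman transform undoes one lowering, and
  its parameter is \<open>y k T\<close>. The polytope inequalities ensure that this value is the
  cap.\<close>

lemma string_set_supset: "x \<in> string_set rt crt T ws \<pi>"
proof -
  define \<eta> where "\<eta> = lowered_path x \<pi> (length ws)"
  have T: "T \<in> {0..T}" using T_pos by simp
  have facts: "lowered_path x \<pi> k \<in> paths T" "\<And>t. t \<in> {0..T} \<Longrightarrow> 0 \<le> z k t"
    if "k < length ws" for k
    using lowered_path_ratio[OF that] by auto
  have path: "\<eta> \<in> paths T"
  proof (cases "length ws")
    case 0
    have "\<pi> \<in> paths T" using dominant by (simp add: dominant_path_def)
    then show ?thesis by (simp only: \<eta>_def 0 lowered_path.simps)
  next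
    case (Suc k)
    then have k: "k < length ws" by simp
    show ?thesis
      unfolding \<eta>_def Suc lowered_path.simps
      by (rule inverse_pitman_in_paths[OF crt_linear crt_rt facts[OF k] x_nonneg[OF k]])
        (use T_pos in auto)
  qed
  have word: "\<forall>t\<in>{0..T}. pitman_word rt crt (drop k ws) \<eta> t = lowered_path x \<pi> k t"
    if "k \<le> length ws" for k
    using that
  proof (induction rule: inc_induct)
    case base
    show ?case by (simp add: \<eta>_def pitman_word_def)
  next
    case (step k)
    show ?case
    proof
      fix t assume t: "t \<in> {0..T}"
      have "pitman_word rt crt (drop k ws) \<eta> t =
          pitman (rt (ws ! k)) (crt (ws ! k)) (lowered_path x \<pi> (Suc k)) t"
        unfolding pitman_word_drop[OF step.hyps(2)]
        using step.IH t by (intro pitman_cong[of T]) auto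
      also have "\<dots> = lowered_path x \<pi> k t"
        unfolding lowered_path.simps
        by (rule pitman_inverse_pitman[OF crt_linear crt_rt facts[OF step.hyps(2)]
              x_nonneg[OF step.hyps(2)] t])
      finally show "pitman_word rt crt (drop k ws) \<eta> t = lowered_path x \<pi> k t" .
    qed
  qed
  have y: "partial_param \<eta> k T = y k T" if k: "k < length ws" for k
  proof -
    have "(INF u\<in>{0..T}. crt (ws ! k) (pitman_word rt crt (drop (Suc k) ws) \<eta> u)) =
        (INF u\<in>{0..T}. crt (ws ! k) (lowered_path x \<pi> (Suc k) u))"
      using word[of "Suc k"] k by (intro INF_cong) auto
    also have "\<dots> = - y k T"
      unfolding lowered_path.simps
      by (rule INF_inverse_pitman[OF crt_linear crt_rt facts[OF k] x_nonneg[OF k] T])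
    finally show ?thesis by (simp add: partial_param_def)
  qed
  have y_x: "y k T = x (Suc k)"
    if "k < length ws"
      "lowered_path x \<pi> k T = \<pi> T - (\<Sum>n\<in>{1..<Suc k}. x n *\<^sub>R rt (ws ! (n - 1)))" for k
  proof -
    have "x r \<le> crt (ws ! (r - 1)) (\<pi> T - (\<Sum>n\<in>{1..<r}. x n *\<^sub>R rt (ws ! (n - 1))))"
      if "r \<in> {1..length ws}" for r
      using x_polytope that unfolding string_polytope_def by blast
    from this[of "Suc k"] have "x (Suc k) \<le> z k T"
      unfolding that(2) using that(1) by simp
    then show ?thesis by (simp add: future_min_def)
  qed
  \<comment> \<open>The end point at stage \<open>k\<close> depends on the earlier parameters being
    exact, and exactness at \<open>k\<close> depends on that end point; induction interlaces the
    two.\<close>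
  have "k < length ws \<Longrightarrow>
      lowered_path x \<pi> k T = \<pi> T - (\<Sum>n\<in>{1..<Suc k}. x n *\<^sub>R rt (ws ! (n - 1)))" for k
  proof (induction k)
    case (Suc k)
    then show ?case
      using y_x[of k] by (simp add: inverse_pitman_def)
  qed simp
  then have params: "string_params rt crt T ws \<eta> (Suc k) = x (Suc k)" if "k < length ws" for k
    using that y y_x by (simp add: string_params_eq)
  have "string_params rt crt T ws \<eta> = x"
  proof (rule extensionalityI)
    show "string_params rt crt T ws \<eta> \<in> extensional {1..length ws}"
      by (simp add: string_params_def)
    show "x \<in> extensional {1..length ws}"
      using x_cone by (simp add: cone_def PiE_iff)
    fix r assume "r \<in> {1..length ws}"
    then show "string_params rt crt T ws \<eta> r = x r"
      using params[of "r - 1"] by auto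
  qed
  then show ?thesis
    unfolding string_set_def using path word[of 0] by auto
qed

end

section \<open>Polyhedrality and uniqueness of the cone\<close>

lemma polyhedral_cone: "polyhedral_cone (length ws) cone"
proof -
  define e :: "nat \<Rightarrow> nat \<Rightarrow> real" where "e k i = of_bool (i = k)" for k i
  \<comment> \<open>The functionals are the coordinates, encoding nonnegativity, and the differences
    of the two sides of each cross-multiplied inequality.\<close>
  define F where "F = e ` {1..length ws} \<union>
    (\<lambda>k i. a (Suc k) * e (Suc (Suc k)) i - a (Suc (Suc k)) * e (Suc k) i) `
      {k. Suc (Suc k) < length ws}"
  have "{k. Suc (Suc k) < length ws} \<subseteq> {..<length ws}" by auto
  then have "finite F"
    unfolding F_def by (intro finite_UnI finite_imageI) (auto intro: finite_subset)
  moreover have "cone = {x \<in> {1..length ws} \<rightarrow>\<^sub>E UNIV. \<forall>f\<in>F. 0 \<le> (\<Sum>i\<in>{1..length ws}. f i * x i)}"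
  proof -
    have e: "(\<Sum>i\<in>{1..length ws}. e k i * x i) = x k"
      if "k \<in> {1..length ws}" for k and x :: "nat \<Rightarrow> real"
    proof -
      have "(\<Sum>i\<in>{1..length ws}. e k i * x i) = (\<Sum>i\<in>{1..length ws}. if i = k then x i else 0)"
        by (intro sum.cong) (auto simp: e_def)
      then show ?thesis using that by simp
    qed
    have d: "(\<Sum>i\<in>{1..length ws}. (b * e k i - b' * e k' i) * x i) = b * x k - b' * x k'"
      if "k \<in> {1..length ws}" "k' \<in> {1..length ws}" for b b' k k' and x :: "nat \<Rightarrow> real"
      using e[OF that(1), of x] e[OF that(2), of x]
      by (simp add: left_diff_distrib sum_subtractf mult.assoc flip: sum_distrib_left)
    have "(\<forall>f\<in>F. 0 \<le> (\<Sum>i\<in>{1..length ws}. f i * x i)) \<longleftrightarrow>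
        (\<forall>k\<in>{1..length ws}. 0 \<le> x k) \<and>
        (\<forall>k. Suc (Suc k) < length ws \<longrightarrow> x (Suc k) * a (Suc (Suc k)) \<le> x (Suc (Suc k)) * a (Suc k))"
      for x :: "nat \<Rightarrow> real"
    proof -
      have "(\<forall>f\<in>e ` {1..length ws}. 0 \<le> (\<Sum>i\<in>{1..length ws}. f i * x i)) \<longleftrightarrow>
          (\<forall>k\<in>{1..length ws}. 0 \<le> x k)"
        using e[of _ x] by simp
      moreover have "0 \<le> (\<Sum>i\<in>{1..length ws}.
            (a (Suc k) * e (Suc (Suc k)) i - a (Suc (Suc k)) * e (Suc k) i) * x i) \<longleftrightarrow>
          x (Suc k) * a (Suc (Suc k)) \<le> x (Suc (Suc k)) * a (Suc k)"
        if "Suc (Suc k) < length ws" for k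
        using that by (subst d) (auto simp: mult.commute)
      ultimately show ?thesis
        unfolding F_def ball_Un by (auto simp only: ball_simps mem_Collect_eq)
    qed
    then show ?thesis unfolding cone_def by (auto simp: PiE_iff)
  qed
  ultimately show ?thesis
    unfolding polyhedral_cone_def by blast
qed

lemma is_string_cone_cone: "is_string_cone rt crt T ws cone"
  unfolding is_string_cone_def
proof (intro conjI allI impI)
  show "cone \<subseteq> {1..length ws} \<rightarrow>\<^sub>E {0..}" by (auto simp: cone_def)
  show "string_set rt crt T ws \<pi> = cone \<inter> string_polytope rt crt T ws \<pi>"
    if "dominant_path crt T \<pi>" for \<pi>
    using string_set_subset string_set_supset[OF that] by blast
qed (rule polyhedral_cone)

text \<open>A straight path along the sum of the simple roots works, since both coroots take the
  value \<open>2 - c > 0\<close> on it. Its speed is chosen so that both coroots reach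
  \<open>M\<close> at time \<open>T\<close>, where \<open>M\<close> dominates every
  \<open>x r + h r\<close>.\<close>

lemma exists_dominant_path:
  assumes c: "c < 2" and x: "x \<in> {1..length ws} \<rightarrow>\<^sub>E {0..}"
  obtains \<pi> where "dominant_path crt T \<pi>" "x \<in> string_polytope rt crt T ws \<pi>"
proof -
  define \<rho> where "\<rho> = rt S_alpha + rt S_beta"
  have \<rho>: "crt i \<rho> = 2 - c" for i
    by (cases i) (simp_all add: \<rho>_def linear_add[OF crt_linear] crt_rt crt_rt_distinct)
  define h where "h r = crt (ws ! (r - 1)) (\<Sum>n\<in>{1..<r}. x n *\<^sub>R rt (ws ! (n - 1)))" for r
  define M where "M = (\<Sum>r\<in>{1..length ws}. \<bar>x r\<bar> + \<bar>h r\<bar>)"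
  have M: "x r + h r \<le> M" if "r \<in> {1..length ws}" for r
    using member_le_sum[of r "{1..length ws}" "\<lambda>r. \<bar>x r\<bar> + \<bar>h r\<bar>"] that by (auto simp: M_def)
  have "0 \<le> M" unfolding M_def by (intro sum_nonneg) auto
  define \<pi> where "\<pi> t = (t * M / (T * (2 - c))) *\<^sub>R \<rho>" for t
  have \<pi>: "crt i (\<pi> t) = t * M / T" for i t
    using c by (simp add: \<pi>_def linear_scale[OF crt_linear] \<rho>)
  have "continuous_on {0..T} \<pi>"
    unfolding \<pi>_def using T_pos c by (intro continuous_intros) auto
  then have "dominant_path crt T \<pi>"
    using \<open>0 \<le> M\<close> T_pos by (auto simp: dominant_path_def paths_def \<pi>) (simp add: \<pi>_def)
  moreover have "x \<in> string_polytope rt crt T ws \<pi>"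
    using x M T_pos
    by (auto simp: string_polytope_def PiE_iff linear_diff[OF crt_linear] \<pi> le_diff_eq h_def)
  ultimately show thesis by (rule that)
qed

text \<open>Two string cones have the same intersection with the polytope of every dominant path,
  and these polytopes cover the nonnegative orthant.\<close>

lemma string_cone_eq:
  assumes "c < 2"
  shows "string_cone rt crt T ws = cone"
  unfolding string_cone_def
proof (rule the_equality)
  show "is_string_cone rt crt T ws cone" by (rule is_string_cone_cone)
next
  fix C assume C: "is_string_cone rt crt T ws C"
  have "x \<in> C \<longleftrightarrow> x \<in> cone" if x: "x \<in> {1..length ws} \<rightarrow>\<^sub>E {0..}" for x
  proof -
    obtain \<pi> where "dominant_path crt T \<pi>" "x \<in> string_polytope rt crt T ws \<pi>"
      using exists_dominant_path[OF assms x] .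
    then show ?thesis
      using C is_string_cone_cone unfolding is_string_cone_def by blast
  qed
  moreover have "C \<subseteq> {1..length ws} \<rightarrow>\<^sub>E {0..}" "cone \<subseteq> {1..length ws} \<rightarrow>\<^sub>E {0..}"
    using C is_string_cone_cone unfolding is_string_cone_def by simp_all
  ultimately show "C = cone" by (meson subsetD subsetI subset_antisym)
qed

end


section \<open>The string cone of the dihedral group\<close>

theorem proposition4p7:
  fixes m :: nat
    and rt :: "simple \<Rightarrow> 'a::euclidean_space"
    and crt :: "simple \<Rightarrow> 'a \<Rightarrow> real"
    and T :: real
    and ws :: "simple list"
    and w0 :: "'a \<Rightarrow> 'a"
    and a :: "nat \<Rightarrow> real"
  assumes "m \<ge> 2"
    and "dihedral_realization m rt crt"
    and "- crt S_alpha (rt S_beta) = 2 * cos (pi / real m)"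
    and "- crt S_beta (rt S_alpha) = 2 * cos (pi / real m)"
    and "\<And>n. a n = sin (real n * pi / real m) / sin (pi / real m)"
    and "T > 0"
    and "longest_element rt crt w0"
    and "reduced_decomposition rt crt ws w0"
    and "length ws = m"
  shows "string_cone rt crt T ws =
    {x \<in> {1..m} \<rightarrow>\<^sub>E {0..}. \<forall>k. 1 \<le> k \<and> k + 1 \<le> m - 1 \<longrightarrow> x (k + 1) / a (k + 1) \<ge> x k / a k}"
proof -
  define \<theta> where "\<theta> = pi / real m"
  have \<theta>: "0 < \<theta>" "\<theta> \<le> pi / 2"
    using assms(1) by (auto simp: \<theta>_def divide_simps)
  then have sin: "0 < sin \<theta>"
    by (intro sin_gt_zero) auto
  have a: "a n = sin (real n * \<theta>) / sin \<theta>" for n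
    using assms(5) by (simp add: \<theta>_def)
  have lin: "\<And>i. linear (crt i)" and two: "\<And>i. crt i (rt i) = 2"
    using assms(2) by (auto simp: dihedral_realization_def)
  have a_pos: "0 < a k" if "0 < k" "k < m" for k
    unfolding a using that sin \<theta>(1)
    by (intro divide_pos_pos sin_gt_zero) (auto simp: \<theta>_def field_simps)
  interpret dihedral_word rt crt "2 * cos \<theta>" ws a T
  proof
    show "crt i (rt j) = - (2 * cos \<theta>)" if "i \<noteq> j" for i j
      using that assms(3,4) by (cases i; cases j) (auto simp: \<theta>_def)
    show "ws ! k \<noteq> ws ! Suc k" if "Suc k < length ws" for k
      using reduced_decomposition_alternating[OF lin two assms(8) that] .
    show "a (Suc (Suc k)) = 2 * cos \<theta> * a (Suc k) - a k" for k
    proof -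
      have "sin (real (Suc (Suc k)) * \<theta>) + sin (real k * \<theta>) =
          2 * cos \<theta> * sin (real (Suc k) * \<theta>)"
        using sin_add[of "real (Suc k) * \<theta>" \<theta>] sin_diff[of "real (Suc k) * \<theta>" \<theta>]
        by (simp add: algebra_simps)
      then show ?thesis
        using sin by (simp add: a field_simps)
    qed
    show "a (length ws) = 0"
      using assms(1,9) by (simp add: a \<theta>_def)
  qed (use linear_add[OF lin] linear_scale[OF lin] two sin a_pos assms(6,9) in \<open>simp_all add: a\<close>)
  \<comment> \<open>This is the condition \<open>c < 2\<close> under which dominant paths reach
    arbitrarily far into the chamber.\<close>
  have "cos \<theta> < 1"
    using cos_monotone_0_pi[of 0 \<theta>] \<theta> by auto
  then have "string_cone rt crt T ws = cone"
    by (intro string_cone_eq) auto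
  also have "\<dots> = {x \<in> {1..m} \<rightarrow>\<^sub>E {0..}.
      \<forall>k. 1 \<le> k \<and> k + 1 \<le> m - 1 \<longrightarrow> x (k + 1) / a (k + 1) \<ge> x k / a k}"
  proof -
    \<comment> \<open>Clearing denominators is legitimate because both indices lie strictly between
      0 and \<open>m\<close>, where \<open>a\<close> is positive.\<close>
    have *: "x k / a k \<le> x (Suc k) / a (Suc k) \<longleftrightarrow> x k * a (Suc k) \<le> x (Suc k) * a k"
      if "1 \<le> k" "Suc k < m" for k and x :: "nat \<Rightarrow> real"
      using a_pos[of k] a_pos[of "Suc k"] that assms(9) by (simp add: field_simps)
    have "(\<forall>k. Suc (Suc k) < m \<longrightarrow> x (Suc k) * a (Suc (Suc k)) \<le> x (Suc (Suc k)) * a (Suc k)) \<longleftrightarrow>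
        (\<forall>k. 1 \<le> k \<and> k + 1 \<le> m - 1 \<longrightarrow> x (k + 1) / a (k + 1) \<ge> x k / a k)"
      (is "?L \<longleftrightarrow> ?R") for x :: "nat \<Rightarrow> real"
    proof
      assume L: ?L
      show ?R
      proof (intro allI impI)
        fix k assume k: "1 \<le> k \<and> k + 1 \<le> m - 1"
        then show "x k / a k \<le> x (k + 1) / a (k + 1)"
          using L[rule_format, of "k - 1"] *[of k x] assms(1) by auto
      qed
    next
      assume R: ?R
      show ?L
      proof (intro allI impI)
        fix k assume "Suc (Suc k) < m"
        then show "x (Suc k) * a (Suc (Suc k)) \<le> x (Suc (Suc k)) * a (Suc k)"
          using R[rule_format, of "Suc k"] *[of "Suc k" x] by auto
      qed
    qed
    then show ?thesis by (simp add: cone_def assms(9))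
  qed
  finally show ?thesis .
qed

end
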